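(* Let $(G,K)$ be a hypergroup Gelfand pair, let $\gamma:\widehat{G^\natural}\to\mathbb{R}_+=[0,\infty)$ be a measurable function and let $s>0$ be a real number. Assume that $\widehat{G^\natural}$ is uniformly bounded and that $(1+\gamma(\cdot)^2)^{-\frac{s}{2}}\in L^2(\widehat{G^\natural})$. Then every $f\in H^{s,\natural}_\gamma(G)$ is bounded, and there exists a constant $C(\gamma,s)>0$ (depending only on $\gamma$ and $s$, not on $f$) such that $$\|f\|_\infty\leqslant C(\gamma,s)\,\|f\|_{H^{s,\natural}_\gamma}\qquad\text{for all } f\in H^{s,\natural}_\gamma(G).$$
   Context: Hypergroups. Let $G$ be a locally compact Hausdorff space, $M(G)$ its Radon measures, $M_b(G)$ the bounded Radon measures, $\delta_x$ the point mass at $x$, and $\mathfrak{C}(G)$ the set of compact subspaces of $G$ with the Michael topology. $G$ is a hypergroup if: (1) there is a binary operation $\ast$ (convolution) turning $M_b(G)$ into an associative algebra such that $(\mu,\nu)\mapsto\mu\ast\nu$ is continuous for the cone topology (on nonnegative bounded measures, the weakest topology making $\mu\mapsto\int f\,d\mu$ continuous for $f=1$ and for every continuous compactly supported $f$), $\delta_x\ast\delta_y$ is a probability measure with compact support for all $x,y\in G$, and $(x,y)\mapsto\mathrm{supp}(\delta_x\ast\delta_y)$ is continuous from $G\times G$ to $\mathfrak{C}(G)$; (2) there is a unique $e\in G$ with $\delta_x\ast\delta_e=\delta_e\ast\delta_x=\delta_x$ for all $x$; (3) there is an involutive homeomorphism $x\mapsto x^\diamond$ of $G$ with $(\delta_x\ast\delta_y)^\diamond=\delta_{y^\diamond}\ast\delta_{x^\diamond}$,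 where $\mu^\diamond(f)=\mu(f^\diamond)$ and $f^\diamond(x)=f(x^\diamond)$; (4) $z\in\mathrm{supp}(\delta_x\ast\delta_y)\iff x\in\mathrm{supp}(\delta_z\ast\delta_{y^\diamond})$. A subhypergroup is a nonempty closed subset $H$ with $x^\diamond\in H$ and $\mathrm{supp}(\delta_x\ast\delta_y)\subset H$ for all $x,y\in H$. Write $f(x\ast y)=\int_G f\,d(\delta_x\ast\delta_y)$, and similarly for more factors; for measures, $(\mu\ast\nu)(f)=\int_G\int_G f(x\ast y)\,d\mu(x)\,d\nu(y)$. Gelfand pairs. $G$ is assumed to carry a left Haar measure $dx$ (a nonzero nonnegative Radon measure with $\int_G f(y\ast x)\,dx=\int_G f(x)\,dx$ for all $y\in G$ and all continuous compactly supported $f$), and $K$ is a compact subhypergroup of $G$ with normalized Haar measure $dk$. A function $f$ is $K$-bi-invariant if $f(k_1\ast x\ast k_2)=f(x)$ for all $k_1,k_2\in K$, $x\in G$ (for $L^p$ functions, understood almost everywhere in $x$). Put $f^\natural(x)=\int_K\int_K f(k_1\ast x\ast k_2)\,dk_1\,dk_2$; a measure $\mu$ is $K$-bi-invariant if $\mu(f^\natural)=\mu(f)$ for all continuous compactly supported $f$. $M_c^\natural(G)$ is the set of compactly supported $K$-bi-invariant complex Radon measures. $(G,K)$ is a (hypergroup) Gelfand pair if $(M_c^\natural(G),\ast)$ is commutative. Dual and Fourier transform. $\widehat{G^\natural}$ is the set of bounded continuous $K$-bi-invariant functions $\phi:G\to\mathbb{C}$ with $\phi(e)=1$, $\int_K\phi(x\ast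 k\ast y)\,dk=\phi(x)\phi(y)$ and $\phi(x^\diamond)=\overline{\phi(x)}$ for all $x,y\in G$, with the topology of uniform convergence on compact sets (it is locally compact Hausdorff). For a $K$-bi-invariant integrable $f$, $\widehat f(\phi)=\int_G\phi(x^\diamond)f(x)\,dx$ for $\phi\in\widehat{G^\natural}$. $\pi$ denotes the Plancherel measure: the unique nonnegative measure on $\widehat{G^\natural}$ such that $\int_G|f(x)|^2dx=\int_{\widehat{G^\natural}}|\widehat f(\phi)|^2d\pi(\phi)$ for all $K$-bi-invariant $f\in L^1(G)\cap L^2(G)$. Let $L^{2,\natural}(G)$ be the space of $K$-bi-invariant functions in $L^2(G)$ and $L^2(\widehat{G^\natural})=L^2(\widehat{G^\natural},\pi)$. It is a known fact that the Fourier transform extends to an isometric isomorphism, still written $f\mapsto\widehat f$, from $L^{2,\natural}(G)$ onto $L^2(\widehat{G^\natural})$. The inverse Fourier transform is $f(x)=\int_{\widehat{G^\natural}}\phi(x)\widehat f(\phi)\,d\pi(\phi)$; an $f\in L^{2,\natural}(G)$ with $\widehat f\in L^1(\widehat{G^\natural},\pi)$ is identified with the representative of its almost-everywhere class given by this formula. Sobolev space. $H^{s,\natural}_\gamma(G)=\{f\in L^{2,\natural}(G):\int_{\widehat{G^\natural}}(1+\gamma(\phi)^2)^s|\widehat f(\phi)|^2d\pi(\phi)<\infty\}$, with norm $\|f\|_{H^{s,\natural}_\gamma}=\left(\int_{\widehat{G^\natural}}(1+\gamma(\phi)^2)^s|\widehat f(\phi)|^2d\pi(\phi)\right)^{1/2}$.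 Other conventions. $\widehat{G^\natural}$ is uniformly bounded if there is a real $M$ with $|\phi(x)|\leqslant M$ for all $x\in G$ and all $\phi\in\widehat{G^\natural}$. $\|f\|_\infty$ is the supremum norm of $f$ on $G$. *)

theory Defs
  imports "HOL-Analysis.Analysis"
begin

section \<open>Radon measures\<close>

definition borel_of :: "'b topology \<Rightarrow> 'b measure" where
  "borel_of X = sigma (topspace X) {U. openin X U}"

text \<open>Nonnegative, possibly infinite, Radon measures on a locally compact Hausdorff space.\<close>

definition radon_measure :: "'b topology \<Rightarrow> 'b measure \<Rightarrow> bool" where
  "radon_measure X M \<longleftrightarrow>
     sets M = sets (borel_of X) \<and>
     (\<forall>L. compactin X L \<longrightarrow> emeasure M L < \<infinity>) \<and>
     (\<forall>A\<in>sets M. emeasure M A = (INF U\<in>{U. openin X U \<and> A \<subseteq> U}. emeasure M U)) \<and>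
     (\<forall>U. openin X U \<longrightarrow> emeasure M U = (SUP L\<in>{L. compactin X L \<and> L \<subseteq> U}. emeasure M L))"

text \<open>
  Bounded complex Radon measures are rendered as regular countably additive complex functions
  on the Borel sets, extended by 0 to the other sets, so that equality of measures is equality
  of functions. The last clause says that the total variation of \<open>U - L\<close> can be made small.
\<close>

type_synonym 'a cmeasure = "'a set \<Rightarrow> complex"

definition Mb :: "'a::topological_space cmeasure set" where
  "Mb = {\<mu>.
     (\<forall>A. A \<notin> sets borel \<longrightarrow> \<mu> A = 0) \<and>
     (\<forall>A::nat \<Rightarrow> 'a set. range A \<subseteq> sets borel \<longrightarrow> disjoint_family A \<longrightarrow>
        (\<lambda>n. \<mu> (A n)) sums \<mu> (\<Union>n. A n)) \<and>
     (\<forall>A\<in>sets borel. \<forall>\<epsilon>>0. \<exists>L U. compact L \<and> open U \<and> L \<subseteq> A \<and> A \<subseteq> U \<and>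
        (\<forall>B\<in>sets borel. B \<subseteq> U - L \<longrightarrow> cmod (\<mu> B) < \<epsilon>))}"

definition Mb_nonneg :: "'a::topological_space cmeasure set" where
  "Mb_nonneg = {\<mu>\<in>Mb. \<forall>A. \<mu> A \<in> \<real>\<^sub>\<ge>\<^sub>0}"

definition dirac :: "'a::topological_space \<Rightarrow> 'a cmeasure" where
  "dirac x = (\<lambda>A. if A \<in> sets borel \<and> x \<in> A then 1 else 0)"

text \<open>The support of the total variation.\<close>

definition msupp :: "'a::topological_space cmeasure \<Rightarrow> 'a set" where
  "msupp \<mu> = {x. \<forall>U. open U \<longrightarrow> x \<in> U \<longrightarrow> (\<exists>B\<in>sets borel. B \<subseteq> U \<and> \<mu> B \<noteq> 0)}"

text \<open>
  The positive part in the Jordan decomposition of a signed measure \<open>\<nu>\<close>; the negative part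
  is that of \<open>-\<nu>\<close>. Integration against a complex measure is reduced to the four Jordan parts
  of its real and imaginary parts.
\<close>

definition jordan_pos :: "('a::topological_space set \<Rightarrow> real) \<Rightarrow> 'a measure" where
  "jordan_pos \<nu> = measure_of UNIV (sets borel)
     (\<lambda>A. SUP B\<in>{B\<in>sets borel. B \<subseteq> A}. ennreal (\<nu> B))"

definition cintegral :: "'a::topological_space cmeasure \<Rightarrow> ('a \<Rightarrow> complex) \<Rightarrow> complex" where
  "cintegral \<mu> f =
     ((\<integral>x. f x \<partial>jordan_pos (\<lambda>A. Re (\<mu> A))) - (\<integral>x. f x \<partial>jordan_pos (\<lambda>A. - Re (\<mu> A)))) +
     \<i> * ((\<integral>x. f x \<partial>jordan_pos (\<lambda>A. Im (\<mu> A))) - (\<integral>x. f x \<partial>jordan_pos (\<lambda>A. - Im (\<mu> A))))"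

definition Cc :: "('a::topological_space \<Rightarrow> complex) set" where
  "Cc = {f. continuous_on UNIV f \<and> compact (closure {x. f x \<noteq> 0})}"

definition cone_topology :: "'a::topological_space cmeasure topology" where
  "cone_topology = topology_generated_by
     {{\<mu>\<in>Mb_nonneg. cintegral \<mu> f \<in> V} | f V. (f = (\<lambda>x. 1) \<or> f \<in> Cc) \<and> open V}"

definition michael_topology :: "'a::topological_space set topology" where
  "michael_topology = topology_generated_by
     {{L. compact L \<and> L \<inter> U \<noteq> {} \<and> L \<subseteq> V} | U V. open U \<and> open V}"


section \<open>Hypergroups\<close>

record 'a hypergroup_data =
  conv :: "'a cmeasure \<Rightarrow> 'a cmeasure \<Rightarrow> 'a cmeasure"
  dia :: "'a \<Rightarrow> 'a"
  unit :: 'a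

abbreviation ptconv :: "('a::topological_space, 'z) hypergroup_data_scheme \<Rightarrow> 'a \<Rightarrow> 'a \<Rightarrow> 'a cmeasure" where
  "ptconv G x y \<equiv> conv G (dirac x) (dirac y)"

text \<open>The value of \<open>f\<close> at a convolution of two or three points.\<close>

definition at2 :: "('a::topological_space, 'z) hypergroup_data_scheme \<Rightarrow> ('a \<Rightarrow> complex) \<Rightarrow> 'a \<Rightarrow> 'a \<Rightarrow> complex" where
  "at2 G f x y = cintegral (ptconv G x y) f"

definition at3 :: "('a::topological_space, 'z) hypergroup_data_scheme \<Rightarrow> ('a \<Rightarrow> complex) \<Rightarrow> 'a \<Rightarrow> 'a \<Rightarrow> 'a \<Rightarrow> complex" where
  "at3 G f x y z = cintegral (conv G (ptconv G x y) (dirac z)) f"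

definition measure_algebra :: "('a::topological_space cmeasure \<Rightarrow> 'a cmeasure \<Rightarrow> 'a cmeasure) \<Rightarrow> bool" where
  "measure_algebra c \<longleftrightarrow>
     (\<forall>\<mu>\<in>Mb. \<forall>\<nu>\<in>Mb. c \<mu> \<nu> \<in> Mb) \<and>
     (\<forall>\<mu>\<in>Mb. \<forall>\<nu>\<in>Mb. \<forall>\<rho>\<in>Mb.
        c (\<lambda>A. \<mu> A + \<nu> A) \<rho> = (\<lambda>A. c \<mu> \<rho> A + c \<nu> \<rho> A) \<and>
        c \<rho> (\<lambda>A. \<mu> A + \<nu> A) = (\<lambda>A. c \<rho> \<mu> A + c \<rho> \<nu> A) \<and>
        c (c \<mu> \<nu>) \<rho> = c \<mu> (c \<nu> \<rho>)) \<and>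
     (\<forall>\<mu>\<in>Mb. \<forall>\<nu>\<in>Mb. \<forall>a.
        c (\<lambda>A. a * \<mu> A) \<nu> = (\<lambda>A. a * c \<mu> \<nu> A) \<and>
        c \<mu> (\<lambda>A. a * \<nu> A) = (\<lambda>A. a * c \<mu> \<nu> A))"

definition is_unit :: "('a::topological_space, 'z) hypergroup_data_scheme \<Rightarrow> 'a \<Rightarrow> bool" where
  "is_unit G e \<longleftrightarrow> (\<forall>x. ptconv G x e = dirac x \<and> ptconv G e x = dirac x)"

text \<open>
  The measure \<open>\<mu>\<close> transported by the involution is its image measure; on functions it is
  \<open>f \<mapsto> \<mu>(f \<circ> dia)\<close>.
\<close>

definition mdia :: "('a::topological_space, 'z) hypergroup_data_scheme \<Rightarrow> 'a cmeasure \<Rightarrow> 'a cmeasure" where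
  "mdia G \<mu> = (\<lambda>A. \<mu> (dia G -` A))"

definition hypergroup :: "('a::t2_space, 'z) hypergroup_data_scheme \<Rightarrow> bool" where
  "hypergroup G \<longleftrightarrow>
     locally_compact_space (euclidean :: 'a topology) \<and>
     measure_algebra (conv G) \<and>
     continuous_map (prod_topology cone_topology cone_topology) cone_topology (\<lambda>(\<mu>, \<nu>). conv G \<mu> \<nu>) \<and>
     (\<forall>x y. ptconv G x y \<in> Mb_nonneg \<and> ptconv G x y UNIV = 1 \<and> compact (msupp (ptconv G x y))) \<and>
     continuous_map euclidean michael_topology (\<lambda>(x, y). msupp (ptconv G x y)) \<and>
     is_unit G (unit G) \<and> (\<forall>e. is_unit G e \<longrightarrow> e = unit G) \<and>
     continuous_on UNIV (dia G) \<and> (\<forall>x. dia G (dia G x) = x) \<and>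
     (\<forall>x y. mdia G (ptconv G x y) = ptconv G (dia G y) (dia G x)) \<and>
     (\<forall>x y z. z \<in> msupp (ptconv G x y) \<longleftrightarrow> x \<in> msupp (ptconv G z (dia G y)))"

definition subhypergroup :: "('a::t2_space, 'z) hypergroup_data_scheme \<Rightarrow> 'a set \<Rightarrow> bool" where
  "subhypergroup G H \<longleftrightarrow> H \<noteq> {} \<and> closed H \<and>
     (\<forall>x\<in>H. dia G x \<in> H) \<and> (\<forall>x\<in>H. \<forall>y\<in>H. msupp (ptconv G x y) \<subseteq> H)"

definition left_haar :: "('a::t2_space, 'z) hypergroup_data_scheme \<Rightarrow> 'a measure \<Rightarrow> bool" where
  "left_haar G m \<longleftrightarrow> radon_measure euclidean m \<and> emeasure m UNIV \<noteq> 0 \<and>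
     (\<forall>f\<in>Cc. \<forall>y. (\<integral>x. at2 G f y x \<partial>m) = (\<integral>x. f x \<partial>m))"

text \<open>
  The normalized Haar measure of a compact subhypergroup \<open>H\<close>, regarded as a measure on the whole
  space concentrated on \<open>H\<close>.
\<close>

definition normalized_haar :: "('a::t2_space, 'z) hypergroup_data_scheme \<Rightarrow> 'a set \<Rightarrow> 'a measure \<Rightarrow> bool" where
  "normalized_haar G H m \<longleftrightarrow> radon_measure euclidean m \<and> emeasure m H = 1 \<and> emeasure m (- H) = 0 \<and>
     (\<forall>f\<in>Cc. \<forall>h\<in>H. (\<integral>k. at2 G f h k \<partial>m) = (\<integral>k. f k \<partial>m))"


section \<open>Gelfand pairs\<close>

record 'a pair_data = "'a hypergroup_data" +
  haar :: "'a measure"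
  K :: "'a set"
  haarK :: "'a measure"

definition biinv :: "('a::t2_space, 'z) pair_data_scheme \<Rightarrow> ('a \<Rightarrow> complex) \<Rightarrow> bool" where
  "biinv G f \<longleftrightarrow> (\<forall>k\<^sub>1\<in>K G. \<forall>k\<^sub>2\<in>K G. \<forall>x. at3 G f k\<^sub>1 x k\<^sub>2 = f x)"

definition biinv_ae :: "('a::t2_space, 'z) pair_data_scheme \<Rightarrow> ('a \<Rightarrow> complex) \<Rightarrow> bool" where
  "biinv_ae G f \<longleftrightarrow> (\<forall>k\<^sub>1\<in>K G. \<forall>k\<^sub>2\<in>K G. AE x in haar G. at3 G f k\<^sub>1 x k\<^sub>2 = f x)"

definition natural :: "('a::t2_space, 'z) pair_data_scheme \<Rightarrow> ('a \<Rightarrow> complex) \<Rightarrow> 'a \<Rightarrow> complex" where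
  "natural G f x = (\<integral>k\<^sub>2. (\<integral>k\<^sub>1. at3 G f k\<^sub>1 x k\<^sub>2 \<partial>haarK G) \<partial>haarK G)"

text \<open>Compactly supported complex Radon measures are automatically bounded.\<close>

definition Mc_natural :: "('a::t2_space, 'z) pair_data_scheme \<Rightarrow> 'a cmeasure set" where
  "Mc_natural G = {\<mu>\<in>Mb. compact (msupp \<mu>) \<and> (\<forall>f\<in>Cc. cintegral \<mu> (natural G f) = cintegral \<mu> f)}"

definition gelfand_pair :: "('a::t2_space, 'z) pair_data_scheme \<Rightarrow> bool" where
  "gelfand_pair G \<longleftrightarrow> hypergroup G \<and> left_haar G (haar G) \<and>
     subhypergroup G (K G) \<and> compact (K G) \<and> normalized_haar G (K G) (haarK G) \<and>
     (\<forall>\<mu>\<in>Mc_natural G. \<forall>\<nu>\<in>Mc_natural G. conv G \<mu> \<nu> = conv G \<nu> \<mu>)"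


section \<open>The dual space and the Fourier transform\<close>

definition dual :: "('a::t2_space, 'z) pair_data_scheme \<Rightarrow> ('a \<Rightarrow> complex) set" where
  "dual G = {\<phi>. continuous_on UNIV \<phi> \<and> bounded (range \<phi>) \<and> biinv G \<phi> \<and> \<phi> (unit G) = 1 \<and>
     (\<forall>x y. (\<integral>k. at3 G \<phi> x k y \<partial>haarK G) = \<phi> x * \<phi> y) \<and>
     (\<forall>x. \<phi> (dia G x) = cnj (\<phi> x))}"

text \<open>
  The topology of uniform convergence on compact sets. It is an abstract topology because the
  library's topology on the function type is that of pointwise convergence.
\<close>

definition dual_topology :: "('a::t2_space, 'z) pair_data_scheme \<Rightarrow> ('a \<Rightarrow> complex) topology" where
  "dual_topology G = topology (\<lambda>U. U \<subseteq> dual G \<and>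
     (\<forall>\<phi>\<in>U. \<exists>L \<epsilon>. compact L \<and> \<epsilon> > 0 \<and> {\<psi>\<in>dual G. \<forall>x\<in>L. dist (\<psi> x) (\<phi> x) < \<epsilon>} \<subseteq> U))"

lemma openin_dual_topology:
  "openin (dual_topology G) U \<longleftrightarrow> U \<subseteq> dual G \<and>
     (\<forall>\<phi>\<in>U. \<exists>L \<epsilon>. compact L \<and> \<epsilon> > 0 \<and> {\<psi>\<in>dual G. \<forall>x\<in>L. dist (\<psi> x) (\<phi> x) < \<epsilon>} \<subseteq> U)"
proof -
  let ?N = "\<lambda>L \<epsilon> \<phi>. {\<psi>\<in>dual G. \<forall>x\<in>L. dist (\<psi> x) (\<phi> x) < (\<epsilon>::real)}"
  have "istopology (\<lambda>U. U \<subseteq> dual G \<and>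
     (\<forall>\<phi>\<in>U. \<exists>L \<epsilon>. compact L \<and> \<epsilon> > 0 \<and> ?N L \<epsilon> \<phi> \<subseteq> U))"
    unfolding istopology_def
  proof (intro conjI allI impI)
    fix S T
    assume S: "S \<subseteq> dual G \<and> (\<forall>\<phi>\<in>S. \<exists>L \<epsilon>. compact L \<and> \<epsilon> > 0 \<and> ?N L \<epsilon> \<phi> \<subseteq> S)"
      and T: "T \<subseteq> dual G \<and> (\<forall>\<phi>\<in>T. \<exists>L \<epsilon>. compact L \<and> \<epsilon> > 0 \<and> ?N L \<epsilon> \<phi> \<subseteq> T)"
    show "S \<inter> T \<subseteq> dual G" using S by auto
    show "\<forall>\<phi>\<in>S \<inter> T. \<exists>L \<epsilon>. compact L \<and> \<epsilon> > 0 \<and> ?N L \<epsilon> \<phi> \<subseteq> S \<inter> T"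
    proof
      fix \<phi> assume \<phi>: "\<phi> \<in> S \<inter> T"
      obtain L1 e1 where 1: "compact L1" "e1 > 0" "?N L1 e1 \<phi> \<subseteq> S" using S \<phi> by blast
      obtain L2 e2 where 2: "compact L2" "e2 > 0" "?N L2 e2 \<phi> \<subseteq> T" using T \<phi> by blast
      have "?N (L1 \<union> L2) (min e1 e2) \<phi> \<subseteq> S \<inter> T" using 1(3) 2(3) by auto
      moreover have "compact (L1 \<union> L2)" "min e1 e2 > 0" using 1 2 by auto
      ultimately show "\<exists>L \<epsilon>. compact L \<and> \<epsilon> > 0 \<and> ?N L \<epsilon> \<phi> \<subseteq> S \<inter> T" by blast
    qed
  next
    fix \<U>
    assume *: "\<forall>S\<in>\<U>. S \<subseteq> dual G \<and> (\<forall>\<phi>\<in>S. \<exists>L \<epsilon>. compact L \<and> \<epsilon> > 0 \<and> ?N L \<epsilon> \<phi> \<subseteq> S)"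
    show "\<Union>\<U> \<subseteq> dual G" using * by auto
    show "\<forall>\<phi>\<in>\<Union>\<U>. \<exists>L \<epsilon>. compact L \<and> \<epsilon> > 0 \<and> ?N L \<epsilon> \<phi> \<subseteq> \<Union>\<U>"
      using * by (meson Union_iff Union_upper subset_trans)
  qed
  then show ?thesis by (simp add: dual_topology_def topology_inverse')
qed

lemma topspace_dual_topology: "topspace (dual_topology G) = dual G"
proof
  show "topspace (dual_topology G) \<subseteq> dual G"
    using openin_topspace[of "dual_topology G"] unfolding openin_dual_topology by auto
  have "openin (dual_topology G) (dual G)"
    unfolding openin_dual_topology by (auto intro!: exI[of _ "{}"] exI[of _ 1])
  then show "dual G \<subseteq> topspace (dual_topology G)" by (rule openin_subset)
qed

definition uniformly_bounded :: "('a::t2_space, 'z) pair_data_scheme \<Rightarrow> bool" where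
  "uniformly_bounded G \<longleftrightarrow> (\<exists>M::real. \<forall>\<phi>\<in>dual G. \<forall>x. cmod (\<phi> x) \<le> M)"

definition square_integrable :: "'b measure \<Rightarrow> ('b \<Rightarrow> complex) \<Rightarrow> bool" where
  "square_integrable M f \<longleftrightarrow> f \<in> borel_measurable M \<and> integrable M (\<lambda>x. (cmod (f x))\<^sup>2)"

text \<open>Elements of the Lebesgue spaces are functions rather than almost-everywhere classes.\<close>

definition L2_natural :: "('a::t2_space, 'z) pair_data_scheme \<Rightarrow> ('a \<Rightarrow> complex) set" where
  "L2_natural G = {f. square_integrable (haar G) f \<and> biinv_ae G f}"

definition L12_natural :: "('a::t2_space, 'z) pair_data_scheme \<Rightarrow> ('a \<Rightarrow> complex) set" where
  "L12_natural G = {f\<in>L2_natural G. integrable (haar G) f}"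

definition fourier1 :: "('a::t2_space, 'z) pair_data_scheme \<Rightarrow> ('a \<Rightarrow> complex) \<Rightarrow> ('a \<Rightarrow> complex) \<Rightarrow> complex" where
  "fourier1 G f \<phi> = (\<integral>x. \<phi> (dia G x) * f x \<partial>haar G)"

definition plancherel_measure :: "('a::t2_space, 'z) pair_data_scheme \<Rightarrow> ('a \<Rightarrow> complex) measure \<Rightarrow> bool" where
  "plancherel_measure G \<pi> \<longleftrightarrow> radon_measure (dual_topology G) \<pi> \<and>
     (\<forall>f\<in>L12_natural G.
        (\<integral>\<^sup>+x. ennreal ((cmod (f x))\<^sup>2) \<partial>haar G) = (\<integral>\<^sup>+\<phi>. ennreal ((cmod (fourier1 G f \<phi>))\<^sup>2) \<partial>\<pi>))"

text \<open>
  The extension of the Fourier transform to square integrable functions, by continuity: \<open>g\<close> is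
  the transform of \<open>f\<close> if it is the mean square limit of the transforms of some integrable
  functions converging to \<open>f\<close> in mean square. By the Plancherel formula \<open>g\<close> is then unique up
  to null sets, and by the Plancherel theorem it exists for every \<open>f\<close> in \<open>L2_natural G\<close>, so that
  the default value 0 plays no role there.
\<close>

definition is_fourier :: "('a::t2_space, 'z) pair_data_scheme \<Rightarrow> ('a \<Rightarrow> complex) measure \<Rightarrow>
    ('a \<Rightarrow> complex) \<Rightarrow> (('a \<Rightarrow> complex) \<Rightarrow> complex) \<Rightarrow> bool" where
  "is_fourier G \<pi> f g \<longleftrightarrow> square_integrable \<pi> g \<and>
     (\<exists>F::nat \<Rightarrow> 'a \<Rightarrow> complex. (\<forall>n. F n \<in> L12_natural G) \<and>
        (\<lambda>n. \<integral>\<^sup>+x. ennreal ((cmod (F n x - f x))\<^sup>2) \<partial>haar G) \<longlonglongrightarrow> 0 \<and>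
        (\<lambda>n. \<integral>\<^sup>+\<phi>. ennreal ((cmod (fourier1 G (F n) \<phi> - g \<phi>))\<^sup>2) \<partial>\<pi>) \<longlonglongrightarrow> 0)"

definition fourier :: "('a::t2_space, 'z) pair_data_scheme \<Rightarrow> ('a \<Rightarrow> complex) measure \<Rightarrow>
    ('a \<Rightarrow> complex) \<Rightarrow> ('a \<Rightarrow> complex) \<Rightarrow> complex" where
  "fourier G \<pi> f = (if \<exists>g. is_fourier G \<pi> f g then SOME g. is_fourier G \<pi> f g else (\<lambda>\<phi>. 0))"

definition inverse_fourier :: "('a \<Rightarrow> complex) measure \<Rightarrow> (('a \<Rightarrow> complex) \<Rightarrow> complex) \<Rightarrow> 'a \<Rightarrow> complex" where
  "inverse_fourier \<pi> g x = (\<integral>\<phi>. \<phi> x * g \<phi> \<partial>\<pi>)"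

text \<open>
  Square integrable functions matter up to null sets only. A class whose Fourier transform is
  integrable is identified with its representative given by the inversion formula; pointwise
  statements, such as boundedness, refer to that representative.
\<close>

definition representative :: "('a::t2_space, 'z) pair_data_scheme \<Rightarrow> ('a \<Rightarrow> complex) measure \<Rightarrow>
    ('a \<Rightarrow> complex) \<Rightarrow> 'a \<Rightarrow> complex" where
  "representative G \<pi> f =
     (if integrable \<pi> (fourier G \<pi> f) then inverse_fourier \<pi> (fourier G \<pi> f) else f)"


section \<open>Sobolev spaces\<close>

definition sobolev_space :: "('a::t2_space, 'z) pair_data_scheme \<Rightarrow> ('a \<Rightarrow> complex) measure \<Rightarrow>
    (('a \<Rightarrow> complex) \<Rightarrow> real) \<Rightarrow> real \<Rightarrow> ('a \<Rightarrow> complex) set" where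
  "sobolev_space G \<pi> \<gamma> s = {f\<in>L2_natural G.
     integrable \<pi> (\<lambda>\<phi>. (1 + (\<gamma> \<phi>)\<^sup>2) powr s * (cmod (fourier G \<pi> f \<phi>))\<^sup>2)}"

definition sobolev_norm :: "('a::t2_space, 'z) pair_data_scheme \<Rightarrow> ('a \<Rightarrow> complex) measure \<Rightarrow>
    (('a \<Rightarrow> complex) \<Rightarrow> real) \<Rightarrow> real \<Rightarrow> ('a \<Rightarrow> complex) \<Rightarrow> real" where
  "sobolev_norm G \<pi> \<gamma> s f =
     sqrt (\<integral>\<phi>. (1 + (\<gamma> \<phi>)\<^sup>2) powr s * (cmod (fourier G \<pi> f \<phi>))\<^sup>2 \<partial>\<pi>)"

text \<open>Only meaningful for bounded functions.\<close>

definition sup_norm :: "('a \<Rightarrow> complex) \<Rightarrow> real" where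
  "sup_norm f = (SUP x. cmod (f x))"

end

theory Submission
  imports Defs
begin

text \<open>
  By the Cauchy-Schwarz inequality, the Fourier transform of a function in the Sobolev space is
  integrable, since it is the product of the square integrable functions
  \<open>(1 + \<gamma>\<^sup>2) powr (- s / 2)\<close> and \<open>(1 + \<gamma>\<^sup>2) powr (s / 2) * fourier G \<pi> f\<close>. As the elements of the
  dual are uniformly bounded, the inversion formula is then bounded by a multiple of the
  \<open>L\<^sup>1\<close> norm of the transform, hence of the Sobolev norm.
\<close>

lemma integrable_mult_of_squares:
  fixes u v :: "'b \<Rightarrow> real"
  assumes "u \<in> borel_measurable M" "v \<in> borel_measurable M"
    and "integrable M (\<lambda>x. (u x)\<^sup>2)" "integrable M (\<lambda>x. (v x)\<^sup>2)"
  shows "integrable M (\<lambda>x. u x * v x)"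
proof (rule Bochner_Integration.integrable_bound)
  show "integrable M (\<lambda>x. (u x)\<^sup>2 + (v x)\<^sup>2)"
    using assms by simp
  \<comment> \<open>From 2ab \<le> a^2 + b^2 with a, b the absolute values; since ab is nonnegative,
    the factor 2 may be dropped.\<close>
  have "\<bar>u x * v x\<bar> \<le> (u x)\<^sup>2 + (v x)\<^sup>2" for x
    using sum_squares_bound[of "\<bar>u x\<bar>" "\<bar>v x\<bar>"] mult_nonneg_nonneg[of "\<bar>u x\<bar>" "\<bar>v x\<bar>"]
    unfolding abs_mult power2_abs by linarith
  then show "AE x in M. norm (u x * v x) \<le> norm ((u x)\<^sup>2 + (v x)\<^sup>2)"
    by simp
qed (use assms in measurable)

text \<open>Transferred from the inequality for \<open>nn_integral\<close>: integrability identifies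
  the two kinds of integral, and nonnegativity lets \<open>ennreal\<close> commute with products and
  squares.\<close>

lemma integral_Cauchy_Schwarz:
  fixes u v :: "'b \<Rightarrow> real"
  assumes [measurable]: "u \<in> borel_measurable M" "v \<in> borel_measurable M"
    and u: "integrable M (\<lambda>x. (u x)\<^sup>2)" and v: "integrable M (\<lambda>x. (v x)\<^sup>2)"
    and nonneg: "\<And>x. 0 \<le> u x" "\<And>x. 0 \<le> v x"
  shows "(\<integral>x. u x * v x \<partial>M) \<le> sqrt (\<integral>x. (u x)\<^sup>2 \<partial>M) * sqrt (\<integral>x. (v x)\<^sup>2 \<partial>M)"
proof -
  have uv: "integrable M (\<lambda>x. u x * v x)"
    using assms(1-4) by (rule integrable_mult_of_squares)
  have "ennreal ((\<integral>x. u x * v x \<partial>M)\<^sup>2) = (\<integral>\<^sup>+x. ennreal (u x) * ennreal (v x) \<partial>M)\<^sup>2"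
    using nn_integral_eq_integral[OF uv] nonneg by (simp add: ennreal_mult ennreal_power)
  also have "\<dots> \<le> (\<integral>\<^sup>+x. (ennreal (u x))\<^sup>2 \<partial>M) * (\<integral>\<^sup>+x. (ennreal (v x))\<^sup>2 \<partial>M)"
    by (rule Cauchy_Schwarz_nn_integral) measurable
  also have "\<dots> = ennreal ((\<integral>x. (u x)\<^sup>2 \<partial>M) * (\<integral>x. (v x)\<^sup>2 \<partial>M))"
    using nn_integral_eq_integral[OF u] nn_integral_eq_integral[OF v] nonneg
    by (simp add: ennreal_mult ennreal_power)
  finally have "(\<integral>x. u x * v x \<partial>M)\<^sup>2 \<le> (\<integral>x. (u x)\<^sup>2 \<partial>M) * (\<integral>x. (v x)\<^sup>2 \<partial>M)"
    by (simp add: ennreal_le_iff)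
  then have "(\<integral>x. u x * v x \<partial>M) \<le> sqrt ((\<integral>x. (u x)\<^sup>2 \<partial>M) * (\<integral>x. (v x)\<^sup>2 \<partial>M))"
    by (rule real_le_rsqrt)
  then show ?thesis
    by (simp add: real_sqrt_mult)
qed

text \<open>Turns bounds valid on the dual space into bounds valid wherever the Plancherel measure
  integrates.\<close>

lemma space_radon_measure:
  assumes "radon_measure X M"
  shows "space M = topspace X"
proof -
  have "space M = space (borel_of X)"
    using assms sets_eq_imp_space_eq unfolding radon_measure_def by blast
  also have "\<dots> = topspace X"
    by (simp add: borel_of_def space_measure_of_conv)
  finally show ?thesis .
qed

text \<open>A transform picked by \<open>SOME\<close> is square integrable, hence measurable; the
  default value is the zero function.\<close>

lemma fourier_measurable:
  "fourier G \<pi> f \<in> borel_measurable \<pi>"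
proof (cases "\<exists>g. is_fourier G \<pi> f g")
  case True
  then have "is_fourier G \<pi> f (fourier G \<pi> f)"
    by (simp add: fourier_def someI_ex)
  then show ?thesis
    by (simp add: is_fourier_def square_integrable_def)
next
  case False
  then show ?thesis
    by (simp add: fourier_def)
qed

lemma cmod_inverse_fourier_le:
  assumes "integrable \<pi> g" "\<And>\<phi> x. \<phi> \<in> space \<pi> \<Longrightarrow> cmod (\<phi> x) \<le> M" "0 \<le> M"
  shows "cmod (inverse_fourier \<pi> g x) \<le> M * (\<integral>\<phi>. cmod (g \<phi>) \<partial>\<pi>)"
proof -
  \<comment> \<open>This and the next estimate do not presuppose that the evaluation of \<phi> at
    \<open>x\<close> is measurable: a nonintegrable function has Bochner integral 0, and the
    right-hand sides are nonnegative.\<close>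
  have "cmod (inverse_fourier \<pi> g x) \<le> (\<integral>\<phi>. cmod (\<phi> x * g \<phi>) \<partial>\<pi>)"
    unfolding inverse_fourier_def by (rule integral_norm_bound)
  also have "\<dots> \<le> (\<integral>\<phi>. M * cmod (g \<phi>) \<partial>\<pi>)"
    using assms by (intro integral_mono') (auto simp: norm_mult intro: mult_right_mono)
  finally show ?thesis
    by simp
qed

lemma sobolev_fourier_integrable:
  assumes [measurable]: "\<gamma> \<in> borel_measurable \<pi>"
    and w: "square_integrable \<pi> (\<lambda>\<phi>. complex_of_real ((1 + (\<gamma> \<phi>)\<^sup>2) powr (- s / 2)))"
    and f: "f \<in> sobolev_space G \<pi> \<gamma> s"
  shows "integrable \<pi> (fourier G \<pi> f)"
    and "(\<integral>\<phi>. cmod (fourier G \<pi> f \<phi>) \<partial>\<pi>)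
      \<le> sqrt (\<integral>\<phi>. (1 + (\<gamma> \<phi>)\<^sup>2) powr (- s) \<partial>\<pi>) * sobolev_norm G \<pi> \<gamma> s f"
proof -
  note [measurable] = fourier_measurable
  let ?w = "\<lambda>\<phi>. 1 + (\<gamma> \<phi>)\<^sup>2"
  let ?u = "\<lambda>\<phi>. ?w \<phi> powr (- s / 2)"
  let ?v = "\<lambda>\<phi>. ?w \<phi> powr (s / 2) * cmod (fourier G \<pi> f \<phi>)"
  \<comment> \<open>Because \<open>0 powr 0 = 0\<close>, the two weights cancel in \<open>uv\<close>
    only for a nonzero base.\<close>
  have w_nz: "?w \<phi> \<noteq> 0" for \<phi>
    using zero_le_power2[of "\<gamma> \<phi>"] by linarith
  have u2: "(?u \<phi>)\<^sup>2 = ?w \<phi> powr (- s)" for \<phi>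
    using powr_add[of "?w \<phi>" "- s / 2" "- s / 2"] by (simp add: power2_eq_square)
  have v2: "(?v \<phi>)\<^sup>2 = ?w \<phi> powr s * (cmod (fourier G \<pi> f \<phi>))\<^sup>2" for \<phi>
    using powr_add[of "?w \<phi>" "s / 2" "s / 2"] by (simp add: power2_eq_square mult_ac)
  have uv: "?u \<phi> * ?v \<phi> = cmod (fourier G \<pi> f \<phi>)" for \<phi>
    using powr_add[of "?w \<phi>" "- s / 2" "s / 2"] w_nz[of \<phi>] by (simp flip: mult.assoc)
  have iu: "integrable \<pi> (\<lambda>\<phi>. (?u \<phi>)\<^sup>2)"
    using w by (simp add: square_integrable_def)
  have iv: "integrable \<pi> (\<lambda>\<phi>. (?v \<phi>)\<^sup>2)"
    using f unfolding v2 by (simp add: sobolev_space_def)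
  have mu: "?u \<in> borel_measurable \<pi>" and mv: "?v \<in> borel_measurable \<pi>"
    by measurable
  show "integrable \<pi> (fourier G \<pi> f)"
    using integrable_mult_of_squares[OF mu mv iu iv] unfolding uv
    by (rule integrable_norm_cancel) measurable
  show "(\<integral>\<phi>. cmod (fourier G \<pi> f \<phi>) \<partial>\<pi>)
      \<le> sqrt (\<integral>\<phi>. ?w \<phi> powr (- s) \<partial>\<pi>) * sobolev_norm G \<pi> \<gamma> s f"
    using integral_Cauchy_Schwarz[OF mu mv iu iv] unfolding uv u2 v2 sobolev_norm_def by simp
qed

theorem theorem3p10:
  fixes G :: "'a::t2_space pair_data"
    and \<pi> :: "('a \<Rightarrow> complex) measure"
    and \<gamma> :: "('a \<Rightarrow> complex) \<Rightarrow> real"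
    and s :: real
  assumes "gelfand_pair G"
    and "plancherel_measure G \<pi>"
    and "\<gamma> \<in> borel_measurable (borel_of (dual_topology G))"
    and "\<And>\<phi>. \<phi> \<in> dual G \<Longrightarrow> 0 \<le> \<gamma> \<phi>"
    and "s > 0"
    and "uniformly_bounded G"
    and "square_integrable \<pi> (\<lambda>\<phi>. complex_of_real ((1 + (\<gamma> \<phi>)\<^sup>2) powr (- s / 2)))"
  shows "\<exists>C>0. \<forall>f\<in>sobolev_space G \<pi> \<gamma> s.
           bounded (range (representative G \<pi> f)) \<and>
           sup_norm (representative G \<pi> f) \<le> C * sobolev_norm G \<pi> \<gamma> s f"
proof -
  have radon: "radon_measure (dual_topology G) \<pi>"
    using assms(2) by (simp add: plancherel_measure_def)
  have space: "space \<pi> = dual G"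
    using space_radon_measure[OF radon] by (simp add: topspace_dual_topology)
  \<comment> \<open>The Plancherel measure lives on the Borel sets of the dual, so Borel
    measurability of \<gamma> carries over to \<pi>.\<close>
  have "sets \<pi> = sets (borel_of (dual_topology G))"
    using radon by (simp add: radon_measure_def)
  from measurable_cong_sets[OF this refl] have \<gamma>: "\<gamma> \<in> borel_measurable \<pi>"
    using assms(3) by blast
  obtain M\<^sub>0 where M\<^sub>0: "\<And>\<phi> x. \<phi> \<in> dual G \<Longrightarrow> cmod (\<phi> x) \<le> M\<^sub>0"
    using assms(6) unfolding uniformly_bounded_def by blast
  \<comment> \<open>The maximum with 1 guarantees a strictly positive factor in the final
    constant.\<close>
  define M where "M = max 1 M\<^sub>0"
  have M: "cmod (\<phi> x) \<le> M" if "\<phi> \<in> space \<pi>" for \<phi> x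
    using M\<^sub>0[of \<phi> x] that space by (simp add: M_def)
  have M_pos: "0 < M"
    by (simp add: M_def)
  \<comment> \<open>The mean square norm of the weight
    \<open>(1 + (\<gamma> \<phi>)\<^sup>2) powr (- s / 2)\<close>.\<close>
  define I where "I = sqrt (\<integral>\<phi>. (1 + (\<gamma> \<phi>)\<^sup>2) powr (- s) \<partial>\<pi>)"
  have I: "0 \<le> I"
    by (simp add: I_def)
  have bound: "cmod (representative G \<pi> f x) \<le> M * (I + 1) * sobolev_norm G \<pi> \<gamma> s f"
    if f: "f \<in> sobolev_space G \<pi> \<gamma> s" for f x
  proof -
    note int = sobolev_fourier_integrable[OF \<gamma> assms(7) f]
    \<comment> \<open>Integrability of the transform selects the inversion formula in
      \<open>representative\<close>.\<close>
    have "cmod (representative G \<pi> f x) \<le> M * (\<integral>\<phi>. cmod (fourier G \<pi> f \<phi>) \<partial>\<pi>)"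
      using cmod_inverse_fourier_le[OF int(1), of M x] M M_pos int(1)
      by (simp add: representative_def)
    also have "\<dots> \<le> M * (I * sobolev_norm G \<pi> \<gamma> s f)"
      using int(2) M_pos by (simp add: I_def)
    \<comment> \<open>Only \<open>0 \<le> I\<close> is known, so \<open>I + 1\<close> replaces
      \<open>I\<close> to keep the constant strictly positive.\<close>
    also have "\<dots> \<le> M * ((I + 1) * sobolev_norm G \<pi> \<gamma> s f)"
      using M_pos by (intro mult_left_mono mult_right_mono) (auto simp: sobolev_norm_def)
    finally show ?thesis
      by (simp add: mult.assoc)
  qed
  show ?thesis
  proof (intro exI[of _ "M * (I + 1)"] conjI ballI)
    show "0 < M * (I + 1)"
      using M_pos I by simp
    fix f
    assume f: "f \<in> sobolev_space G \<pi> \<gamma> s"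
    show "bounded (range (representative G \<pi> f))"
      using bound[OF f] by (auto intro: boundedI)
    show "sup_norm (representative G \<pi> f) \<le> M * (I + 1) * sobolev_norm G \<pi> \<gamma> s f"
      unfolding sup_norm_def using bound[OF f] by (intro cSUP_least) auto
  qed
qed

end
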